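(* Let $\mathbb{K}\in\{\mathbb{R},\mathbb{C}\}$, let $\mathbf{P} \in \mathbb{R}^{k_1 \times \cdots \times k_d \times k_1 \times \cdots \times k_d}$ be the tensor of Ulam's method and $\hat{P} \in \mathbb{R}^{\hat{k} \times \hat{k}}$, $\hat{k} = \prod_{\mu=1}^d k_\mu$, the matrix of Ulam's method, both built from the same dynamical system $S$, the same boxes and the same test points (as defined in the context). Let $\mathbf{v} \in \mathbb{K}^{k_1 \times \cdots \times k_d}$, let $v = \operatorname{vec}(\mathbf{v}) \in \mathbb{K}^{\hat{k}}$ be its vectorization, and let $\lambda \in \mathbb{K}$. Then $$\mathbf{P}\mathbf{v} = \lambda \mathbf{v} \quad\Leftrightarrow\quad \hat{P} v = \lambda v.$$
   Context: Setting. Let $S : \mathcal{X} \to \mathcal{X}$, $\mathcal{X} \subset \mathbb{R}^d$, be a dynamical system, and let $\mathcal{B} = \mathcal{I}_1 \times \cdots \times \mathcal{I}_d \supset \mathcal{X}$ be a box, where each $\mathcal{I}_\mu = [a_\mu, b_\mu] \subset \mathbb{R}$ is an interval. Each $\mathcal{I}_\mu$ is partitioned into $k_\mu$ subintervals $\mathcal{I}_\mu^{i_\mu}$, $i_\mu = 1, \dots, k_\mu$, with $\mathcal{I}_\mu^{i_\mu} \cap \mathcal{I}_\mu^{j_\mu} = \varnothing$ for $i_\mu \neq j_\mu$. This partitions $\mathcal{B}$ into $\hat{k} = \prod_{\mu=1}^d k_\mu$ boxes $\mathcal{B}_{\mathbf{i}} = \mathcal{I}_1^{i_1} \times \cdots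 \times \mathcal{I}_d^{i_d}$, indexed by multi-indices $\mathbf{i} = (i_1, \dots, i_d)$ with $1 \le i_\mu \le k_\mu$. Index mapping. Each multi-index $\mathbf{i}$ corresponds to the number $$\hat{i} = 1 + \sum_{\mu=1}^d \Big( \prod_{\nu=1}^{\mu-1} k_\nu \Big)(i_\mu - 1) \in \{1, \dots, \hat{k}\},$$ and we write $\mathcal{B}_{\hat{i}} = \mathcal{B}_{\mathbf{i}}$. For a tensor $\mathbf{v}$ of size $k_1 \times \cdots \times k_d$ (a multidimensional array), the vectorization $v = \operatorname{vec}(\mathbf{v})$ is the vector of length $\hat{k}$ with $v_{\hat{i}} = \mathbf{v}[i_1, \dots, i_d]$. Test points. For each box $\mathcal{B}_{\mathbf{i}}$, test points $x_{\mathbf{i}}^{(l)} = x_{i_1, \dots, i_d}^{(l)} = x_{\hat{i}}^{(l)} \in \mathcal{B}_{\mathbf{i}}$, $l = 1, \dots, n$, at which $S$ is defined, are given. Matrix of Ulam's method. $\hat{P} = (\hat{P}_{\hat{i}\hat{j}}) \in \mathbb{R}^{\hat{k} \times \hat{k}}$ with $$\hat{P}_{\hat{i}\hat{j}} = \frac{1}{n} \sum_{l=1}^n \mathbf{1}_{\mathcal{B}_{\hat{j}}}\big(S(x_{\hat{i}}^{(l)})\big),$$ where $\mathbf{1}_E$ denotes the indicator function of a set $E$. Tensor of Ulam's method. With $Q_\mu : \mathbb{R}^d \to \mathbb{R}$, $Q_\mu(x) = x_\mu$, the projection onto the $\mu$-th component, $$\mathbf{P}[i_1, \dots, i_d, j_1,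 \dots, j_d] = \frac{1}{n} \sum_{l=1}^n \prod_{\mu=1}^d \mathbf{1}_{\mathcal{I}_\mu^{j_\mu}}\Big( Q_\mu\big(S(x_{i_1, \dots, i_d}^{(l)})\big) \Big).$$ Tensor operator-vector product. $$(\mathbf{P}\mathbf{v})[i_1, \dots, i_d] = \sum_{j_1=1}^{k_1} \cdots \sum_{j_d=1}^{k_d} \mathbf{P}[i_1, \dots, i_d, j_1, \dots, j_d]\, \mathbf{v}[j_1, \dots, j_d].$$ The product $\hat{P} v$ is the usual matrix-vector product. *)

theory Defs
  imports "HOL-Analysis.Analysis" "Jordan_Normal_Form.Matrix"
begin

no_notation vec_index (infixl "$" 100)

text \<open>
  \<open>\<real>\<^sup>d\<close> is \<^typ>\<open>real ^ 'd\<close>. The linear order on the coordinate type \<open>'d\<close> is only needed for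
  the index mapping: the elements of \<open>'d\<close> in increasing order play the role of \<open>1, \<dots>, d\<close>.
  Multi-indices are 1-based, with values \<open>i \<mu> \<in> {1..k \<mu>}\<close>.
\<close>

definition multi_indices :: "('d \<Rightarrow> nat) \<Rightarrow> ('d \<Rightarrow> nat) set" where
  "multi_indices k = {i. \<forall>\<mu>. i \<mu> \<in> {1..k \<mu>}}"

definition flat_index :: "('d::{finite,linorder} \<Rightarrow> nat) \<Rightarrow> ('d \<Rightarrow> nat) \<Rightarrow> nat" where
  "flat_index k i = 1 + (\<Sum>\<mu>\<in>UNIV. (\<Prod>\<nu>\<in>{..<\<mu>}. k \<nu>) * (i \<mu> - 1))"

definition multi_index :: "('d::{finite,linorder} \<Rightarrow> nat) \<Rightarrow> nat \<Rightarrow> ('d \<Rightarrow> nat)" where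
  "multi_index k = the_inv_into (multi_indices k) (flat_index k)"

definition sub_box :: "('d::finite \<Rightarrow> nat \<Rightarrow> real set) \<Rightarrow> ('d \<Rightarrow> nat) \<Rightarrow> (real ^ 'd) set" where
  "sub_box J i = {y. \<forall>\<mu>. y $ \<mu> \<in> J \<mu> (i \<mu>)}"

definition interval_partition :: "real \<Rightarrow> real \<Rightarrow> nat \<Rightarrow> (nat \<Rightarrow> real set) \<Rightarrow> bool" where
  "interval_partition a b m J \<longleftrightarrow>
     (\<forall>i\<in>{1..m}. is_interval (J i) \<and> J i \<noteq> {}) \<and>
     disjoint_family_on J {1..m} \<and>
     (\<Union>i\<in>{1..m}. J i) = {a..b}"

text \<open>
  A tensor of size \<open>k\<^sub>1 \<times> \<dots> \<times> k\<^sub>d\<close> is an extensional function on the multi-indices, so that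
  equality of tensors is equality of all entries.
\<close>

definition tensors :: "('d \<Rightarrow> nat) \<Rightarrow> (('d \<Rightarrow> nat) \<Rightarrow> 'a) set" where
  "tensors k = (multi_indices k \<rightarrow>\<^sub>E UNIV)"

definition tensor_scale :: "('d \<Rightarrow> nat) \<Rightarrow> 'a::times \<Rightarrow> (('d \<Rightarrow> nat) \<Rightarrow> 'a) \<Rightarrow> (('d \<Rightarrow> nat) \<Rightarrow> 'a)" where
  "tensor_scale k c v = (\<lambda>i\<in>multi_indices k. c * v i)"

definition tensor_mult_vec ::
  "('d \<Rightarrow> nat) \<Rightarrow> (('d \<Rightarrow> nat) \<Rightarrow> ('d \<Rightarrow> nat) \<Rightarrow> 'a::comm_semiring_0) \<Rightarrow>
   (('d \<Rightarrow> nat) \<Rightarrow> 'a) \<Rightarrow> (('d \<Rightarrow> nat) \<Rightarrow> 'a)" where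
  "tensor_mult_vec k T v = (\<lambda>i\<in>multi_indices k. \<Sum>j\<in>multi_indices k. T i j * v j)"

text \<open>
  Library vectors and matrices are 0-based: position \<open>m\<close> holds the entry with 1-based number
  \<open>m + 1\<close>.
\<close>

definition vectorize :: "('d::{finite,linorder} \<Rightarrow> nat) \<Rightarrow> (('d \<Rightarrow> nat) \<Rightarrow> 'a) \<Rightarrow> 'a Matrix.vec" where
  "vectorize k v = Matrix.vec (\<Prod>\<mu>\<in>UNIV. k \<mu>) (\<lambda>m. v (multi_index k (m + 1)))"

definition ulam_matrix ::
  "('d::{finite,linorder} \<Rightarrow> nat) \<Rightarrow> ('d \<Rightarrow> nat \<Rightarrow> real set) \<Rightarrow> (real ^ ('d::{finite,linorder}) \<Rightarrow>
    real ^ ('d::{finite,linorder})) \<Rightarrow>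
   nat \<Rightarrow> (('d \<Rightarrow> nat) \<Rightarrow> nat \<Rightarrow> real ^ ('d::{finite,linorder})) \<Rightarrow> real Matrix.mat" where
  "ulam_matrix k J S n x =
     Matrix.mat (\<Prod>\<mu>\<in>UNIV. k \<mu>) (\<Prod>\<mu>\<in>UNIV. k \<mu>) (\<lambda>(p, q).
       1 / real n * (\<Sum>l=1..n.
         indicat_real (sub_box J (multi_index k (q + 1))) (S (x (multi_index k (p + 1)) l))))"

definition ulam_tensor ::
  "('d::finite \<Rightarrow> nat \<Rightarrow> real set) \<Rightarrow> (real ^ 'd \<Rightarrow> real ^ 'd) \<Rightarrow>
   nat \<Rightarrow> (('d \<Rightarrow> nat) \<Rightarrow> nat \<Rightarrow> real ^ 'd) \<Rightarrow> ('d \<Rightarrow> nat) \<Rightarrow> ('d \<Rightarrow> nat) \<Rightarrow> real" where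
  "ulam_tensor J S n x i j =
     1 / real n * (\<Sum>l=1..n. \<Prod>\<mu>\<in>UNIV. indicat_real (J \<mu> (j \<mu>)) (S (x i l) $ \<mu>))"

end

theory Submission
  imports Defs
begin

text \<open>
  The index mapping is, up to the offset 1, a mixed radix expansion, hence a bijection between
  multi-indices and \<open>{1..\<Prod>\<mu>. k \<mu>}\<close>. Vectorization therefore is an injective map that turns
  the action of a tensor operator into that of its flattened matrix. A point lies in a box iff each of
  its coordinates lies in the corresponding interval, so the indicator of a box is the product of the
  indicators of its sides, and Ulam's matrix is the flattening of Ulam's tensor.
\<close>

text \<open>Taking the sum over a set \<open>A\<close> of coordinates, with weights formed inside
  \<open>A\<close>, makes induction on the coordinates possible; \<open>A = UNIV\<close> gives the
  index mapping without its offset 1.\<close>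

definition mixed_radix :: "('d::linorder \<Rightarrow> nat) \<Rightarrow> 'd set \<Rightarrow> ('d \<Rightarrow> nat) \<Rightarrow> nat" where
  "mixed_radix k A i = (\<Sum>\<mu>\<in>A. (\<Prod>\<nu>\<in>{\<nu>\<in>A. \<nu> < \<mu>}. k \<nu>) * (i \<mu> - 1))"

text \<open>A new largest coordinate lies below no element of \<open>A\<close>, so the old weights
  stay as they are and \<open>b\<close> becomes the most significant digit.\<close>

lemma mixed_radix_insert_max:
  fixes k :: "'d::linorder \<Rightarrow> nat"
  assumes "finite A" "\<forall>a\<in>A. a < b"
  shows "mixed_radix k (insert b A) i = (\<Prod>\<mu>\<in>A. k \<mu>) * (i b - 1) + mixed_radix k A i"
proof -
  have "b \<notin> A" and b: "{\<nu>\<in>insert b A. \<nu> < b} = A"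
    using assms(2) by auto
  have A: "{\<nu>\<in>insert b A. \<nu> < \<mu>} = {\<nu>\<in>A. \<nu> < \<mu>}" if "\<mu> \<in> A" for \<mu>
    using assms(2) that by auto
  have "(\<Sum>\<mu>\<in>A. (\<Prod>\<nu>\<in>{\<nu>\<in>insert b A. \<nu> < \<mu>}. k \<nu>) * (i \<mu> - 1)) = mixed_radix k A i"
    unfolding mixed_radix_def by (rule sum.cong) (simp_all only: A)
  then show ?thesis
    unfolding mixed_radix_def[of k "insert b A"] sum.insert[OF assms(1) \<open>b \<notin> A\<close>] b by simp
qed

lemma mixed_radix_less:
  assumes "finite A" "\<forall>\<mu>\<in>A. i \<mu> \<in> {1..k \<mu>}"
  shows "mixed_radix k A i < (\<Prod>\<mu>\<in>A. k \<mu>)"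
  using assms
proof (induction A rule: finite_linorder_max_induct)
  case empty
  show ?case
    by (simp add: mixed_radix_def)
next
  case (insert b A)
  let ?P = "\<Prod>\<mu>\<in>A. k \<mu>"
  have "b \<notin> A"
    using insert.hyps by blast
  have ib: "1 \<le> i b" "i b \<le> k b"
    using insert.prems by auto
  have "mixed_radix k A i < ?P"
    using insert.IH insert.prems by blast
  then have "?P * (i b - 1) + mixed_radix k A i < ?P * (i b - 1) + ?P"
    by (rule add_strict_left_mono)
  \<comment> \<open>Truncated subtraction makes this depend on \<open>1 \<le> i b\<close>.\<close>
  also have "\<dots> = ?P * i b"
    using ib by (cases "i b") auto
  also have "\<dots> \<le> ?P * k b"
    using ib(2) by (rule mult_le_mono2)
  finally show ?case
    using insert.hyps(1) \<open>b \<notin> A\<close>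
    unfolding mixed_radix_insert_max[OF insert.hyps(1,2)] by (simp add: mult.commute)
qed

text \<open>Digits are recovered from the top: the lower part is less than the weight
  \<open>?P\<close> of the leading digit, so division by \<open>?P\<close> isolates that digit and
  the remainder is the value on \<open>A\<close>.\<close>

lemma mixed_radix_inject:
  assumes "finite A" "\<forall>\<mu>\<in>A. i \<mu> \<in> {1..k \<mu>}" "\<forall>\<mu>\<in>A. j \<mu> \<in> {1..k \<mu>}"
    and "mixed_radix k A i = mixed_radix k A j"
  shows "\<forall>\<mu>\<in>A. i \<mu> = j \<mu>"
  using assms
proof (induction A rule: finite_linorder_max_induct)
  case (insert b A)
  let ?P = "\<Prod>\<mu>\<in>A. k \<mu>"
  have ij: "\<forall>\<mu>\<in>A. i \<mu> \<in> {1..k \<mu>}" "\<forall>\<mu>\<in>A. j \<mu> \<in> {1..k \<mu>}" "1 \<le> i b" "1 \<le> j b"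
    using insert.prems(1,2) by auto
  have less: "mixed_radix k A i < ?P" "mixed_radix k A j < ?P"
    using insert.hyps(1) ij by (blast intro: mixed_radix_less)+
  have eq: "?P * (i b - 1) + mixed_radix k A i = ?P * (j b - 1) + mixed_radix k A j"
    using insert.prems(3) unfolding mixed_radix_insert_max[OF insert.hyps(1,2)] .
  have "i b - 1 = j b - 1"
    using arg_cong[OF eq, of "\<lambda>m. m div ?P"] less by (simp del: One_nat_def)
  then have "i b = j b"
    using ij by linarith
  moreover have "mixed_radix k A i = mixed_radix k A j"
    using arg_cong[OF eq, of "\<lambda>m. m mod ?P"] less by simp
  then have "\<forall>\<mu>\<in>A. i \<mu> = j \<mu>"
    by (rule insert.IH[OF ij(1,2)])
  ultimately show ?case
    by simp
qed simp

lemma flat_index_mixed_radix: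
  fixes k :: "'d::{finite,linorder} \<Rightarrow> nat"
  shows "flat_index k i = Suc (mixed_radix k UNIV i)"
  by (simp add: flat_index_def mixed_radix_def lessThan_def)

lemma flat_index_bij_betw:
  fixes k :: "'d::{finite,linorder} \<Rightarrow> nat"
  shows "bij_betw (flat_index k) (multi_indices k) {1..\<Prod>\<mu>\<in>UNIV. k \<mu>}"
proof (rule bij_betw_imageI)
  show inj: "inj_on (flat_index k) (multi_indices k)"
  proof (rule inj_onI)
    fix i j assume "i \<in> multi_indices k" "j \<in> multi_indices k" "flat_index k i = flat_index k j"
    then show "i = j"
      by (intro ext mixed_radix_inject[of UNIV i k j, rule_format])
        (simp_all add: flat_index_mixed_radix multi_indices_def)
  qed
  have sub: "flat_index k ` multi_indices k \<subseteq> {1..\<Prod>\<mu>\<in>UNIV. k \<mu>}"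
  proof (rule image_subsetI)
    fix i assume "i \<in> multi_indices k"
    then have "mixed_radix k UNIV i < (\<Prod>\<mu>\<in>UNIV. k \<mu>)"
      by (intro mixed_radix_less) (simp_all add: multi_indices_def)
    then show "flat_index k i \<in> {1..\<Prod>\<mu>\<in>UNIV. k \<mu>}"
      by (simp add: flat_index_mixed_radix Suc_le_eq)
  qed
  \<comment> \<open>Surjectivity comes from counting: an injective image inside a finite set of the
    same cardinality is the whole set.\<close>
  have "multi_indices k = (\<Pi>\<^sub>E \<mu>\<in>UNIV. {1..k \<mu>})"
    by (auto simp: multi_indices_def)
  then have "card (multi_indices k) = (\<Prod>\<mu>\<in>UNIV. k \<mu>)"
    by (simp add: card_PiE)
  then show "flat_index k ` multi_indices k = {1..\<Prod>\<mu>\<in>UNIV. k \<mu>}"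
    using sub by (intro card_subset_eq) (auto simp: card_image inj)
qed

text \<open>The inverse of the index mapping, preceded by the shift from 0-based positions to
  1-based numbers; sums over positions and over multi-indices are exchanged along it.\<close>

lemma multi_index_bij_betw:
  fixes k :: "'d::{finite,linorder} \<Rightarrow> nat"
  shows "bij_betw (\<lambda>m. multi_index k (m + 1)) {..<\<Prod>\<mu>\<in>UNIV. k \<mu>} (multi_indices k)"
proof -
  have "bij_betw (\<lambda>m. m + 1) {..<N} {1..N}" for N :: nat
    by (rule bij_betw_byWitness[where f' = "\<lambda>m. m - 1"]) auto
  from bij_betw_trans[OF this bij_betw_the_inv_into[OF flat_index_bij_betw[of k]]]
  show ?thesis
    by (simp add: multi_index_def comp_def)
qed

text \<open>Discharges the domain condition when a restricted tensor is evaluated;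
  \<open>Suc m\<close> is the simplifier's form of \<open>m + 1\<close>.\<close>

lemma multi_index_mem:
  fixes k :: "'d::{finite,linorder} \<Rightarrow> nat"
  shows "m < (\<Prod>\<mu>\<in>UNIV. k \<mu>) \<Longrightarrow> multi_index k (Suc m) \<in> multi_indices k"
  using bij_betwE[OF multi_index_bij_betw[of k]] by simp

text \<open>Every multi-index occurs at some position, which fixes all entries; off the
  multi-indices, extensionality makes both tensors \<open>undefined\<close>.\<close>

lemma vectorize_inject:
  fixes k :: "'d::{finite,linorder} \<Rightarrow> nat"
  assumes "v \<in> tensors k" "w \<in> tensors k"
  shows "vectorize k v = vectorize k w \<longleftrightarrow> v = w"
proof
  assume eq: "vectorize k v = vectorize k w"
  show "v = w"
  proof (rule PiE_ext)
    fix i assume "i \<in> multi_indices k"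
    then obtain m where m: "m < (\<Prod>\<mu>\<in>UNIV. k \<mu>)" "i = multi_index k (m + 1)"
      using bij_betw_imp_surj_on[OF multi_index_bij_betw[of k]] by blast
    show "v i = w i"
      using arg_cong[OF eq, of "\<lambda>u. vec_index u m"] m by (simp add: vectorize_def)
  qed (use assms in \<open>auto simp: tensors_def\<close>)
qed simp

lemma vectorize_tensor_scale:
  fixes k :: "'d::{finite,linorder} \<Rightarrow> nat"
  shows "vectorize k (tensor_scale k c v) = c \<cdot>\<^sub>v vectorize k v"
  by (rule eq_vecI) (simp_all add: vectorize_def tensor_scale_def multi_index_mem)

text \<open>The entry type is left open so that one flattening serves both the real and the complex
  case.\<close>

definition tensor_matrix ::
  "('d::{finite,linorder} \<Rightarrow> nat) \<Rightarrow> (('d \<Rightarrow> nat) \<Rightarrow> ('d \<Rightarrow> nat) \<Rightarrow> 'a) \<Rightarrow> 'a Matrix.mat" where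
  "tensor_matrix k T = Matrix.mat (\<Prod>\<mu>\<in>UNIV. k \<mu>) (\<Prod>\<mu>\<in>UNIV. k \<mu>)
     (\<lambda>(p, q). T (multi_index k (p + 1)) (multi_index k (q + 1)))"

lemma vectorize_tensor_mult_vec:
  fixes k :: "'d::{finite,linorder} \<Rightarrow> nat"
  shows "vectorize k (tensor_mult_vec k T v) = tensor_matrix k T *\<^sub>v vectorize k v"
proof (rule eq_vecI)
  let ?N = "\<Prod>\<mu>\<in>UNIV. k \<mu>"
  fix p assume "p < dim_vec (tensor_matrix k T *\<^sub>v vectorize k v)"
  then have p: "p < ?N"
    by (simp add: tensor_matrix_def)
  then have "vec_index (vectorize k (tensor_mult_vec k T v)) p =
      (\<Sum>j\<in>multi_indices k. T (multi_index k (p + 1)) j * v j)"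
    by (simp add: vectorize_def tensor_mult_vec_def multi_index_mem)
  also have "\<dots> = (\<Sum>q<?N. T (multi_index k (p + 1)) (multi_index k (q + 1)) * v (multi_index k (q + 1)))"
    by (rule sum.reindex_bij_betw[OF multi_index_bij_betw, symmetric])
  also have "\<dots> = vec_index (tensor_matrix k T *\<^sub>v vectorize k v) p"
    using p by (simp add: tensor_matrix_def vectorize_def scalar_prod_def atLeast0LessThan)
  finally show "vec_index (vectorize k (tensor_mult_vec k T v)) p =
      vec_index (tensor_matrix k T *\<^sub>v vectorize k v) p" .
qed (simp add: tensor_matrix_def vectorize_def)

lemma tensor_eigen_iff:
  fixes k :: "'d::{finite,linorder} \<Rightarrow> nat"
  shows "tensor_mult_vec k T v = tensor_scale k c v \<longleftrightarrow>
    tensor_matrix k T *\<^sub>v vectorize k v = c \<cdot>\<^sub>v vectorize k v"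
proof -
  \<comment> \<open>Both sides are restricted to the multi-indices by construction, so injectivity
    of \<open>vectorize\<close> applies to them.\<close>
  have "tensor_mult_vec k T v \<in> tensors k" "tensor_scale k c v \<in> tensors k"
    by (auto simp: tensor_mult_vec_def tensor_scale_def tensors_def)
  from vectorize_inject[OF this] show ?thesis
    by (simp add: vectorize_tensor_mult_vec vectorize_tensor_scale)
qed

lemma indicat_sub_box:
  "indicat_real (sub_box J j) y = (\<Prod>\<mu>\<in>UNIV. indicat_real (J \<mu> (j \<mu>)) (y $ \<mu>))"
  by (auto simp: sub_box_def indicator_def prod_zero_iff)

lemma ulam_matrix_eq:
  "ulam_matrix k J S n x = tensor_matrix k (ulam_tensor J S n x)"
  by (simp add: ulam_matrix_def tensor_matrix_def ulam_tensor_def indicat_sub_box)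

text \<open>With \<open>f = complex_of_real\<close>, this presents the complexified Ulam matrix as
  the flattening of the complexified tensor.\<close>

lemma map_mat_tensor_matrix:
  "map_mat f (tensor_matrix k T) = tensor_matrix k (\<lambda>i j. f (T i j))"
  by (rule eq_matI) (simp_all add: tensor_matrix_def)

theorem proposition4p2:
  fixes X :: "(real ^ ('d::{finite,linorder})) set"
    and S :: "real ^ ('d::{finite,linorder}) \<Rightarrow> real ^ ('d::{finite,linorder})"
    and a b :: "real ^ ('d::{finite,linorder})"
    and k :: "'d \<Rightarrow> nat"
    and J :: "'d \<Rightarrow> nat \<Rightarrow> real set"
    and n :: nat
    and x :: "('d \<Rightarrow> nat) \<Rightarrow> nat \<Rightarrow> real ^ ('d::{finite,linorder})"
  assumes "S \<in> X \<rightarrow> X"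
    and "\<And>\<mu>. a $ \<mu> \<le> b $ \<mu>"
    and "X \<subseteq> cbox a b"
    and "\<And>\<mu>. interval_partition (a $ \<mu>) (b $ \<mu>) (k \<mu>) (J \<mu>)"
    and "n \<ge> 1"
    and "\<And>i l. i \<in> multi_indices k \<Longrightarrow> l \<in> {1..n} \<Longrightarrow> x i l \<in> sub_box J i \<inter> X"
  shows
    "(\<forall>v \<in> tensors k. \<forall>c :: real.
        tensor_mult_vec k (ulam_tensor J S n x) v = tensor_scale k c v \<longleftrightarrow>
        ulam_matrix k J S n x *\<^sub>v vectorize k v = c \<cdot>\<^sub>v vectorize k v) \<and>
     (\<forall>v \<in> tensors k. \<forall>c :: complex.
        tensor_mult_vec k (\<lambda>i j. complex_of_real (ulam_tensor J S n x i j)) v = tensor_scale k c v \<longleftrightarrow>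
        map_mat complex_of_real (ulam_matrix k J S n x) *\<^sub>v vectorize k v = c \<cdot>\<^sub>v vectorize k v)"
  \<comment> \<open>Once both matrices are written as flattenings, each conjunct is an instance of
    \<open>tensor_eigen_iff\<close>.\<close>
  by (simp add: ulam_matrix_eq map_mat_tensor_matrix tensor_eigen_iff)

end
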